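(* Consider the autonomous system $$\frac{du_0}{dt} = u_1 u_0^{-2},\qquad \frac{du_1}{dt} = u_1^2 u_0^{-1}$$ with initial data $(u_0(0), u_1(0))$, where $u_0(0)>0$. For sufficiently large $u_1(0)>0$, the $u_1$-component of the solution blows up at some $t=t_{\max}<\infty$ with the blow-up rate $$u_1(t) \sim C(t_{\max}-t)^{-1}\left(\log (t_{\max}-t)^{-1}\right)^{1/2}\quad \text{as } t\to t_{\max},$$ while $u_0(t)$ also blows up, with the rate $$u_0(t) \sim C\left(\log (t_{\max}-t)^{-1}\right)^{1/2}\quad \text{as } t\to t_{\max}.$$
   Context: Here $f\sim g$ as $t\to t_{\max}$ means $\lim_{t\to t_{\max}-0}|f(t)/g(t)| = 1$. The symbol $C$ denotes a generic positive constant: each asymptotic relation holds for some constant $C>0$, and the constants in different relations may differ. $t_{\max}$ denotes the maximal existence time of the solution; a component blows up at $t_{\max}<\infty$ if it tends to infinity in modulus as $t\to t_{\max}-0$. *)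

theory Defs
  imports Complex_Main "HOL-Library.Extended_Real"
begin

text \<open>
  \<open>(u0, u1)\<close> solves \<open>u0' = u1 u0\<^sup>-\<^sup>2\<close>, \<open>u1' = u1\<^sup>2 u0\<^sup>-\<^sup>1\<close> on \<open>[0, T)\<close>,
  \<open>0 < T \<le> \<infinity>\<close>, with initial data \<open>(a, b)\<close>. The right-hand side is only
  defined for \<open>u0 \<noteq> 0\<close>; this is demanded explicitly since division is total in HOL.
  The derivative at \<open>0\<close> is one-sided; values of \<open>u0\<close>, \<open>u1\<close> outside \<open>[0, T)\<close> are irrelevant.
\<close>

definition solution_on ::
  "real \<Rightarrow> real \<Rightarrow> ereal \<Rightarrow> (real \<Rightarrow> real) \<Rightarrow> (real \<Rightarrow> real) \<Rightarrow> bool"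
where
  "solution_on a b T u0 u1 \<longleftrightarrow>
     0 < T \<and> u0 0 = a \<and> u1 0 = b \<and>
     (\<forall>t\<ge>0. ereal t < T \<longrightarrow>
        u0 t \<noteq> 0 \<and>
        (u0 has_real_derivative u1 t / (u0 t)\<^sup>2) (at t within {0..}) \<and>
        (u1 has_real_derivative (u1 t)\<^sup>2 / u0 t) (at t within {0..}))"

text \<open>Maximal to the right, i.e. \<open>T\<close> is the maximal existence time.\<close>

definition maximal_solution ::
  "real \<Rightarrow> real \<Rightarrow> ereal \<Rightarrow> (real \<Rightarrow> real) \<Rightarrow> (real \<Rightarrow> real) \<Rightarrow> bool"
where
  "maximal_solution a b T u0 u1 \<longleftrightarrow>
     solution_on a b T u0 u1 \<and>
     \<not> (\<exists>T' v0 v1. T < T' \<and> solution_on a b T' v0 v1 \<and>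
          (\<forall>t\<ge>0. ereal t < T \<longrightarrow> v0 t = u0 t \<and> v1 t = u1 t))"

definition blows_up_at :: "(real \<Rightarrow> real) \<Rightarrow> real \<Rightarrow> bool" where
  "blows_up_at u T \<longleftrightarrow> filterlim (\<lambda>t. \<bar>u t\<bar>) at_top (at_left T)"

text \<open>
  The modulus makes this relation insensitive to signs, unlike the relation
  \<open>asymp_equiv\<close> of the library.
\<close>

definition asymp_as_left :: "(real \<Rightarrow> real) \<Rightarrow> (real \<Rightarrow> real) \<Rightarrow> real \<Rightarrow> bool" where
  "asymp_as_left f g T \<longleftrightarrow> ((\<lambda>t. \<bar>f t / g t\<bar>) \<longlongrightarrow> 1) (at_left T)"

end

theory Submission
  imports Defs "HOL-Analysis.Analysis" "HOL-Real_Asymp.Real_Asymp"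
begin

text \<open>
  The quantity \<open>u1 exp (- u0\<^sup>2 / 2)\<close> is conserved, because the two equations give
  \<open>du1 / du0 = u0 u1\<close>.  Writing \<open>K > 0\<close> for its value, the system reduces to the scalar equation
  \<open>u0\<^sup>2 exp (- u0\<^sup>2 / 2) u0' = K\<close>.  With the tail
  \<open>W x = \<integral>\<^sub>x\<^sup>\<infinity> s\<^sup>2 exp (- s\<^sup>2 / 2) ds\<close> this integrates to \<open>W (u0 t) = W a - K t\<close>
  (lemma \<open>solution_implicit\<close>).  Since \<open>W\<close> is a decreasing bijection from the positive
  axis onto an interval with left endpoint \<open>0\<close>, the solution is unique, lives exactly until
  \<open>t\<^sub>* = W a / K\<close>, and satisfies \<open>W (u0 t) = K (t\<^sub>* - t)\<close>; in particular \<open>u0\<close> tends to infinity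
  (lemmas \<open>explicit_solution\<close>, \<open>lifetime_le\<close>, \<open>solution_tendsto_infinity\<close>).

  The rates come from the two-sided bound
  \<open>x exp (- x\<^sup>2 / 2) \<le> W x \<le> (x + 1 / x) exp (- x\<^sup>2 / 2)\<close>: it shows that
  \<open>ln (1 / (t\<^sub>* - t)) \<sim> u0\<^sup>2 / 2\<close>, which is the rate of \<open>u0\<close>, and that
  \<open>u1 = K exp (u0\<^sup>2 / 2) \<sim> u0 / (t\<^sub>* - t)\<close>, which is then the rate of \<open>u1\<close>.
\<close>

section \<open>The tail of the second Gaussian moment\<close>

definition gauss_moment :: "real \<Rightarrow> real" where
  "gauss_moment x = integral {0..x} (\<lambda>s. s\<^sup>2 * exp (- s\<^sup>2 / 2))"

text \<open>
  This is \<open>\<integral>\<^sub>x\<^sup>\<infinity> s\<^sup>2 exp (- s\<^sup>2 / 2) ds\<close>.  Taking the supremum of the increasing primitive instead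
  of an improper integral makes the derivative immediate and reduces both bounds on the tail to the
  monotonicity of elementary corrections of the primitive.
\<close>

definition gauss_tail :: "real \<Rightarrow> real" where
  "gauss_tail x = (SUP y\<in>{0<..}. gauss_moment y) - gauss_moment x"

lemma gauss_moment_deriv:
  assumes "x > 0"
  shows "(gauss_moment has_real_derivative x\<^sup>2 * exp (- x\<^sup>2 / 2)) (at x)"
proof -
  have "((\<lambda>u. integral {0..u} (\<lambda>s. s\<^sup>2 * exp (- s\<^sup>2 / 2))) has_real_derivative
      x\<^sup>2 * exp (- x\<^sup>2 / 2)) (at x within {0..x + 1})"
    using assms by (intro integral_has_real_derivative) (auto intro!: continuous_intros)
  moreover have "at x within {0..x + 1} = at x"
    using assms by (intro at_within_interior) auto
  ultimately show ?thesis
    unfolding gauss_moment_def[abs_def] by simp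
qed

text \<open>
  Differentiating \<open>x exp (- x\<^sup>2 / 2)\<close> reproduces the integrand up to the sign and an error
  \<open>exp (- x\<^sup>2 / 2)\<close>; adding that product to the primitive therefore leaves an increasing function.
\<close>

lemma gauss_moment_lower_mono:
  assumes "0 < x" "x \<le> y"
  shows "gauss_moment x + x * exp (- x\<^sup>2 / 2) \<le> gauss_moment y + y * exp (- y\<^sup>2 / 2)"
proof (rule DERIV_nonneg_imp_nondecreasing[OF assms(2)])
  fix z assume "x \<le> z" "z \<le> y"
  with assms have z: "z > 0" by simp
  have "((\<lambda>x. gauss_moment x + x * exp (- x\<^sup>2 / 2)) has_real_derivative exp (- z\<^sup>2 / 2)) (at z)"
    using z
    by (auto intro!: derivative_eq_intros gauss_moment_deriv simp: power2_eq_square algebra_simps)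
  then show "\<exists>d. ((\<lambda>x. gauss_moment x + x * exp (- x\<^sup>2 / 2)) has_real_derivative d) (at z) \<and> 0 \<le> d"
    by (intro exI[of _ "exp (- z\<^sup>2 / 2)"]) auto
qed

text \<open>
  The next term \<open>1 / x\<close> of the asymptotic expansion over-corrects that error: the derivative
  becomes \<open>- exp (- x\<^sup>2 / 2) / x\<^sup>2\<close>.
\<close>

lemma gauss_moment_upper_mono:
  assumes "0 < x" "x \<le> y"
  shows "gauss_moment y + (y + 1 / y) * exp (- y\<^sup>2 / 2)
       \<le> gauss_moment x + (x + 1 / x) * exp (- x\<^sup>2 / 2)"
proof (rule DERIV_nonpos_imp_nonincreasing[OF assms(2)])
  fix z assume "x \<le> z" "z \<le> y"
  with assms have z: "z > 0" by simp
  have "((\<lambda>x. gauss_moment x + (x + 1 / x) * exp (- x\<^sup>2 / 2)) has_real_derivative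
      - (exp (- z\<^sup>2 / 2) / z\<^sup>2)) (at z)"
    using z
    by (auto intro!: derivative_eq_intros gauss_moment_deriv simp: power2_eq_square field_simps)
  then show "\<exists>d. ((\<lambda>x. gauss_moment x + (x + 1 / x) * exp (- x\<^sup>2 / 2)) has_real_derivative d) (at z) \<and> d \<le> 0"
    by (intro exI[of _ "- (exp (- z\<^sup>2 / 2) / z\<^sup>2)"]) auto
qed

text \<open>
  The increasing correction lies below the decreasing one at every point, hence every value of the
  former lies below every value of the latter: compare both at the larger argument.
\<close>

lemma gauss_moment_le:
  assumes "0 < x" "0 < y"
  shows "gauss_moment y \<le> gauss_moment x + (x + 1 / x) * exp (- x\<^sup>2 / 2)"
proof -
  let ?z = "max x y" and ?e = "\<lambda>x::real. exp (- x\<^sup>2 / 2)"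
  have "gauss_moment y \<le> gauss_moment y + y * ?e y" using assms by simp
  also have "\<dots> \<le> gauss_moment ?z + ?z * ?e ?z"
    using assms by (intro gauss_moment_lower_mono) auto
  also have "\<dots> \<le> gauss_moment ?z + (?z + 1 / ?z) * ?e ?z"
    using assms by (intro add_left_mono mult_right_mono) auto
  also have "\<dots> \<le> gauss_moment x + (x + 1 / x) * ?e x"
    using assms by (intro gauss_moment_upper_mono) auto
  finally show ?thesis .
qed

lemma gauss_tail_le:
  assumes "x > 0"
  shows "gauss_tail x \<le> (x + 1 / x) * exp (- x\<^sup>2 / 2)"
proof -
  have "(SUP y\<in>{0<..}. gauss_moment y) \<le> gauss_moment x + (x + 1 / x) * exp (- x\<^sup>2 / 2)"
    using assms by (intro cSUP_least gauss_moment_le) auto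
  then show ?thesis by (simp add: gauss_tail_def)
qed

lemma gauss_tail_ge:
  assumes "x > 0"
  shows "x * exp (- x\<^sup>2 / 2) \<le> gauss_tail x"
proof -
  let ?L = "SUP y\<in>{0<..}. gauss_moment y"
  have bdd: "bdd_above (gauss_moment ` {0<..})"
    using gauss_moment_le[of 1] by (intro bdd_aboveI2) auto
  have "gauss_moment x + x * exp (- x\<^sup>2 / 2) \<le> ?L"
  proof (rule tendsto_lowerbound)
    show "((\<lambda>y. ?L + y * exp (- y\<^sup>2 / 2)) \<longlongrightarrow> ?L) at_top"
    proof -
      have "((\<lambda>y::real. y * exp (- y\<^sup>2 / 2)) \<longlongrightarrow> 0) at_top" by real_asymp
      from tendsto_add[OF tendsto_const[of ?L] this] show ?thesis by simp
    qed
    show "\<forall>\<^sub>F y in at_top. gauss_moment x + x * exp (- x\<^sup>2 / 2) \<le> ?L + y * exp (- y\<^sup>2 / 2)"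
      using eventually_ge_at_top[of x]
    proof eventually_elim
      case (elim y)
      have "gauss_moment y \<le> ?L"
        using assms elim by (intro cSUP_upper bdd) auto
      with gauss_moment_lower_mono[OF assms elim] show ?case by linarith
    qed
  qed simp
  then show ?thesis by (simp add: gauss_tail_def)
qed

lemma gauss_tail_pos:
  assumes "x > 0"
  shows "gauss_tail x > 0"
proof -
  have "0 < x * exp (- x\<^sup>2 / 2)" using assms by simp
  with gauss_tail_ge[OF assms] show ?thesis by linarith
qed

lemma gauss_tail_deriv:
  assumes "x > 0"
  shows "(gauss_tail has_real_derivative - (x\<^sup>2 * exp (- x\<^sup>2 / 2))) (at x)"
  unfolding gauss_tail_def[abs_def]
  using assms by (auto intro!: derivative_eq_intros gauss_moment_deriv)

lemma gauss_tail_strict_antimono: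
  assumes "0 < x" "x < y"
  shows "gauss_tail y < gauss_tail x"
proof (rule DERIV_neg_imp_decreasing[OF assms(2)])
  fix z assume "x \<le> z" "z \<le> y"
  with assms have z: "z > 0" by simp
  show "\<exists>d. (gauss_tail has_real_derivative d) (at z) \<and> d < 0"
    using gauss_tail_deriv[OF z] z
    by (intro exI[of _ "- (z\<^sup>2 * exp (- z\<^sup>2 / 2))"]) auto
qed

lemma gauss_tail_less_iff:
  assumes "0 < x" "0 < y"
  shows "gauss_tail y < gauss_tail x \<longleftrightarrow> x < y"
  using assms gauss_tail_strict_antimono by (metis less_asym' linorder_neqE_linordered_idom)

lemma inj_on_gauss_tail: "inj_on gauss_tail {0<..}"
  by (rule inj_onI) (metis gauss_tail_less_iff greaterThan_iff less_irrefl linorder_neqE_linordered_idom)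

lemma continuous_on_gauss_tail: "continuous_on {0<..} gauss_tail"
  by (intro continuous_at_imp_continuous_on) (auto intro: DERIV_isCont gauss_tail_deriv)

lemma gauss_tail_tendsto_0: "(gauss_tail \<longlongrightarrow> 0) at_top"
proof (rule tendsto_sandwich)
  show "\<forall>\<^sub>F x in at_top. gauss_tail x \<le> (x + 1 / x) * exp (- x\<^sup>2 / 2)"
    using eventually_gt_at_top[of "0::real"] by eventually_elim (rule gauss_tail_le)
  show "\<forall>\<^sub>F x in at_top. 0 \<le> gauss_tail x"
    using eventually_gt_at_top[of "0::real"] by eventually_elim (intro less_imp_le gauss_tail_pos)
  show "((\<lambda>x. (x + 1 / x) * exp (- x\<^sup>2 / 2)) \<longlongrightarrow> (0::real)) at_top" by real_asymp
qed simp

lemma gauss_tail_surj: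
  assumes "0 < a" "0 < y" "y \<le> gauss_tail a"
  shows "\<exists>x>0. gauss_tail x = y"
proof -
  have "\<forall>\<^sub>F x in at_top. gauss_tail x < y"
    using gauss_tail_tendsto_0 assms(2) by (rule order_tendstoD)
  with eventually_ge_at_top[of a] have "\<forall>\<^sub>F x in at_top. a \<le> x \<and> gauss_tail x < y"
    by eventually_elim simp
  then obtain z where z: "a \<le> z" "gauss_tail z < y"
    by (auto dest: eventually_happens)
  have "continuous_on {a..z} gauss_tail"
    using assms(1) by (intro continuous_on_subset[OF continuous_on_gauss_tail]) auto
  with IVT2'[of gauss_tail z y a] z assms(3) obtain x where "a \<le> x" "gauss_tail x = y"
    by (auto simp: less_imp_le)
  with assms(1) show ?thesis by (intro exI[of _ x]) auto
qed

section \<open>Asymptotics of the tail\<close>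

lemma gauss_tail_asymp: "((\<lambda>x. gauss_tail x * exp (x\<^sup>2 / 2) / x) \<longlongrightarrow> 1) at_top"
proof (rule tendsto_sandwich)
  show "\<forall>\<^sub>F x in at_top. 1 \<le> gauss_tail x * exp (x\<^sup>2 / 2) / x"
    using eventually_gt_at_top[of "0::real"]
  proof eventually_elim
    case (elim x)
    have "x * exp (- x\<^sup>2 / 2) * exp (x\<^sup>2 / 2) \<le> gauss_tail x * exp (x\<^sup>2 / 2)"
      by (intro mult_right_mono gauss_tail_ge elim) simp
    then show ?case using elim by (simp add: mult.assoc flip: exp_add)
  qed
  show "\<forall>\<^sub>F x in at_top. gauss_tail x * exp (x\<^sup>2 / 2) / x \<le> 1 + 1 / x\<^sup>2"
    using eventually_gt_at_top[of "0::real"]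
  proof eventually_elim
    case (elim x)
    have "gauss_tail x * exp (x\<^sup>2 / 2) \<le> (x + 1 / x) * exp (- x\<^sup>2 / 2) * exp (x\<^sup>2 / 2)"
      by (intro mult_right_mono gauss_tail_le elim) simp
    then have "gauss_tail x * exp (x\<^sup>2 / 2) \<le> x + 1 / x"
      by (simp add: mult.assoc flip: exp_add)
    then show ?case using elim by (simp add: field_simps power2_eq_square)
  qed
  show "((\<lambda>x::real. 1 + 1 / x\<^sup>2) \<longlongrightarrow> 1) at_top" by real_asymp
qed simp

text \<open>
  Taking logarithms in the previous asymptotics, \<open>ln (K / W x) = x\<^sup>2 / 2 - ln x + ln K + o(1)\<close>.
\<close>

lemma ln_gauss_tail_asymp:
  assumes "K > 0"
  shows "((\<lambda>x. ln (K / gauss_tail x) / x\<^sup>2) \<longlongrightarrow> 1 / 2) at_top"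
proof -
  let ?r = "\<lambda>x. gauss_tail x * exp (x\<^sup>2 / 2) / x"
  have "((\<lambda>x. ln (?r x)) \<longlongrightarrow> ln 1) at_top"
    by (intro tendsto_ln gauss_tail_asymp) simp
  moreover have "filterlim (\<lambda>x::real. x\<^sup>2) at_infinity at_top"
    by (intro filterlim_at_top_imp_at_infinity) real_asymp
  ultimately have "((\<lambda>x. ln (?r x) / x\<^sup>2) \<longlongrightarrow> 0) at_top"
    by (rule tendsto_divide_0)
  moreover have "((\<lambda>x. (ln K - ln x) / x\<^sup>2 + 1 / 2) \<longlongrightarrow> 1 / 2) at_top"
    by real_asymp
  ultimately have "((\<lambda>x. ((ln K - ln x) / x\<^sup>2 + 1 / 2) - ln (?r x) / x\<^sup>2) \<longlongrightarrow> 1 / 2 - 0) at_top"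
    by (intro tendsto_diff)
  moreover have "\<forall>\<^sub>F x in at_top. ((ln K - ln x) / x\<^sup>2 + 1 / 2) - ln (?r x) / x\<^sup>2
      = ln (K / gauss_tail x) / x\<^sup>2"
    using eventually_gt_at_top[of "0::real"]
  proof eventually_elim
    case (elim x)
    with assms gauss_tail_pos[OF elim] show ?case
      by (simp add: ln_mult ln_div field_simps)
  qed
  ultimately show ?thesis by (simp add: filterlim_cong)
qed

lemma sqrt_ln_gauss_tail_asymp:
  assumes "K > 0"
  shows "((\<lambda>x. x / (sqrt 2 * ln (K / gauss_tail x) powr (1 / 2))) \<longlongrightarrow> 1) at_top"
proof -
  let ?h = "\<lambda>x. ln (K / gauss_tail x)"
  have "((\<lambda>x. 1 / (sqrt 2 * sqrt (?h x / x\<^sup>2))) \<longlongrightarrow> 1 / (sqrt 2 * sqrt (1 / 2))) at_top"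
    by (intro tendsto_intros ln_gauss_tail_asymp assms) auto
  then have "((\<lambda>x. 1 / (sqrt 2 * sqrt (?h x / x\<^sup>2))) \<longlongrightarrow> 1) at_top"
    by (simp add: real_sqrt_divide)
  moreover have "\<forall>\<^sub>F x in at_top. 1 / (sqrt 2 * sqrt (?h x / x\<^sup>2)) =
      x / (sqrt 2 * ?h x powr (1 / 2))"
    using eventually_gt_at_top[of "0::real"]
      order_tendstoD(1)[OF ln_gauss_tail_asymp[OF assms], of 0, simplified]
  proof eventually_elim
    case (elim x)
    then have "?h x > 0" by (simp add: zero_less_divide_iff)
    with elim show ?case by (simp add: real_sqrt_divide powr_half_sqrt)
  qed
  ultimately show ?thesis by (rule Lim_transform_eventually)
qed

section \<open>Solutions of the system\<close>

text \<open>
  The right-hand side requires \<open>u0 \<noteq> 0\<close> only, but a continuous \<open>u0\<close> starting at \<open>a > 0\<close> cannot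
  change sign; this keeps the solution in the region where the tail is invertible.
\<close>

lemma solution_pos:
  assumes sol: "solution_on a b T u0 u1" and "a > 0" and t: "0 \<le> t" "ereal t < T"
  shows "u0 t > 0"
proof (rule ccontr)
  assume "\<not> u0 t > 0"
  have D: "(u0 has_real_derivative u1 s / (u0 s)\<^sup>2) (at s within {0..t})" and nz: "u0 s \<noteq> 0"
    if "s \<in> {0..t}" for s
  proof -
    have "ereal s \<le> ereal t" using that by simp
    then have "ereal s < T" using t(2) by (rule order.strict_trans1)
    with sol that show "(u0 has_real_derivative u1 s / (u0 s)\<^sup>2) (at s within {0..t})" "u0 s \<noteq> 0"
      unfolding solution_on_def by (auto intro: DERIV_subset)
  qed
  have "continuous_on {0..t} u0"
    using D unfolding continuous_on_eq_continuous_within by (blast intro: DERIV_continuous)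
  moreover have "u0 0 = a" using sol by (simp add: solution_on_def)
  ultimately obtain s where "0 \<le> s" "s \<le> t" "u0 s = 0"
    using IVT2'[of u0 t 0 0] \<open>\<not> u0 t > 0\<close> \<open>a > 0\<close> t by auto
  with nz show False by auto
qed

text \<open>
  Both identities say that a function of time has zero derivative: first the conserved quantity
  \<open>u1 exp (- u0\<^sup>2 / 2)\<close>, and then, once \<open>u1\<close> is eliminated, \<open>W (u0 t) + K t\<close>.
\<close>

lemma solution_implicit:
  assumes sol: "solution_on a b T u0 u1" and "a > 0" and t: "0 \<le> t" "ereal t < T"
  shows "u1 t = b * exp (- a\<^sup>2 / 2) * exp ((u0 t)\<^sup>2 / 2)"
    and "gauss_tail (u0 t) = gauss_tail a - b * exp (- a\<^sup>2 / 2) * t"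
proof -
  define K where "K = b * exp (- a\<^sup>2 / 2)"
  have init: "u0 0 = a" "u1 0 = b" using sol by (auto simp: solution_on_def)
  have less: "ereal s < T" if "s \<in> {0..t}" for s
  proof -
    have "ereal s \<le> ereal t" using that by simp
    then show ?thesis using t(2) by (rule order.strict_trans1)
  qed
  have D0: "(u0 has_real_derivative u1 s / (u0 s)\<^sup>2) (at s within {0..t})"
    and D1: "(u1 has_real_derivative (u1 s)\<^sup>2 / u0 s) (at s within {0..t})"
    and pos: "u0 s > 0"
    if "s \<in> {0..t}" for s
    using sol that less[OF that] solution_pos[OF sol \<open>a > 0\<close>, of s]
    unfolding solution_on_def by (auto intro: DERIV_subset)
  have "\<exists>c. \<forall>s\<in>{0..t}. u1 s * exp (- (u0 s)\<^sup>2 / 2) = c"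
  proof (rule has_field_derivative_zero_constant)
    fix s assume s: "s \<in> {0..t}"
    show "((\<lambda>s. u1 s * exp (- (u0 s)\<^sup>2 / 2)) has_real_derivative 0) (at s within {0..t})"
      using pos[OF s]
      by (auto intro!: derivative_eq_intros D0[OF s] D1[OF s] simp: field_simps power2_eq_square)
  qed simp
  then obtain c where c: "\<And>s. s \<in> {0..t} \<Longrightarrow> u1 s * exp (- (u0 s)\<^sup>2 / 2) = c" by blast
  from c[of 0] init t have cK: "c = K" by (simp add: K_def)
  have u1: "u1 s = K * exp ((u0 s)\<^sup>2 / 2)" if "s \<in> {0..t}" for s
    using c[OF that] unfolding cK by (simp add: exp_minus field_simps)
  have "\<exists>c. \<forall>s\<in>{0..t}. gauss_tail (u0 s) + K * s = c"
  proof (rule has_field_derivative_zero_constant)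
    fix s assume s: "s \<in> {0..t}"
    show "((\<lambda>s. gauss_tail (u0 s) + K * s) has_real_derivative 0) (at s within {0..t})"
      using pos[OF s] u1[OF s]
      by (auto intro!: derivative_eq_intros DERIV_chain2[OF gauss_tail_deriv D0[OF s]]
          simp: field_simps exp_minus)
  qed simp
  then obtain c' where c': "\<And>s. s \<in> {0..t} \<Longrightarrow> gauss_tail (u0 s) + K * s = c'" by blast
  from c'[of 0] c'[of t] init t show "gauss_tail (u0 t) = gauss_tail a - b * exp (- a\<^sup>2 / 2) * t"
    by (simp add: K_def)
  from u1[of t] t show "u1 t = b * exp (- a\<^sup>2 / 2) * exp ((u0 t)\<^sup>2 / 2)"
    by (simp add: K_def)
qed

definition lifetime :: "real \<Rightarrow> real \<Rightarrow> real" where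
  "lifetime a b = gauss_tail a / (b * exp (- a\<^sup>2 / 2))"

lemma lifetime_pos: "a > 0 \<Longrightarrow> b > 0 \<Longrightarrow> lifetime a b > 0"
  by (simp add: lifetime_def gauss_tail_pos)

lemma gauss_tail_solution:
  assumes "solution_on a b T u0 u1" "a > 0" "b > 0" "0 \<le> t" "ereal t < T"
  shows "gauss_tail (u0 t) = b * exp (- a\<^sup>2 / 2) * (lifetime a b - t)"
  using solution_implicit(2)[OF assms(1,2,4,5)] assms(3)
  by (simp add: lifetime_def algebra_simps)

text \<open>
  At any time of existence the tail at \<open>u0 t\<close> is positive, so \<open>t\<close> precedes \<open>W a / K\<close>.
\<close>

lemma lifetime_le:
  assumes sol: "solution_on a b T u0 u1" and "a > 0" "b > 0"
  shows "T \<le> ereal (lifetime a b)"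
proof (rule ccontr)
  assume "\<not> ?thesis"
  then have "ereal (lifetime a b) < T" by simp
  moreover have "0 \<le> lifetime a b" using lifetime_pos assms(2,3) by (simp add: less_imp_le)
  ultimately have "gauss_tail (u0 (lifetime a b)) = 0" "u0 (lifetime a b) > 0"
    using gauss_tail_solution[OF assms, of "lifetime a b"] solution_pos[OF sol \<open>a > 0\<close>] by auto
  with gauss_tail_pos show False by fastforce
qed

text \<open>
  The solution is obtained by inverting the tail on the positive axis.  Inverting on the whole
  open axis rather than on \<open>{a..}\<close> makes the inverse differentiable on both
  sides of the initial time too.
\<close>

lemma explicit_solution:
  assumes "a > 0" "b > 0"
  shows "\<exists>u0 u1. solution_on a b (ereal (lifetime a b)) u0 u1"
proof -
  define K where "K = b * exp (- a\<^sup>2 / 2)"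
  define u0 where "u0 t = inv_into {0<..} gauss_tail (gauss_tail a - K * t)" for t
  define u1 where "u1 t = K * exp ((u0 t)\<^sup>2 / 2)" for t
  have K: "K > 0" using assms by (simp add: K_def)
  have inv: "inv_into {0<..} gauss_tail (gauss_tail x) = x" if "x > 0" for x
    using that by (intro inv_into_f_f inj_on_gauss_tail) simp
  have u0_0: "u0 0 = a" using assms inv by (simp add: u0_def)
  have "u1 0 = b" by (simp add: u1_def u0_0 K_def exp_minus)
  moreover have "u0 t \<noteq> 0 \<and> (u0 has_real_derivative u1 t / (u0 t)\<^sup>2) (at t within {0..}) \<and>
        (u1 has_real_derivative (u1 t)\<^sup>2 / u0 t) (at t within {0..})"
    if t: "t \<ge> 0" "t < lifetime a b" for t
  proof -
    have "lifetime a b = gauss_tail a / K" by (simp add: lifetime_def K_def)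
    then have "gauss_tail a - K * t > 0" "gauss_tail a - K * t \<le> gauss_tail a"
      using t K by (auto simp: pos_less_divide_eq mult.commute)
    with gauss_tail_surj[OF \<open>a > 0\<close>] obtain x where x: "x > 0" "gauss_tail x = gauss_tail a - K * t"
      by blast
    have u0t: "u0 t = x" using inv[OF x(1)] by (simp add: u0_def flip: x(2))
    have "(inv_into {0<..} gauss_tail has_real_derivative inverse (- (x\<^sup>2 * exp (- x\<^sup>2 / 2))))
        (at (gauss_tail x))"
      unfolding has_field_derivative_def
    proof (rule has_derivative_inverse_strong[where S = "{0<..}" and f = gauss_tail])
      show "(gauss_tail has_derivative (*) (- (x\<^sup>2 * exp (- x\<^sup>2 / 2)))) (at x)"
        using gauss_tail_deriv[OF x(1)] by (simp add: has_field_derivative_def)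
      show "(*) (- (x\<^sup>2 * exp (- x\<^sup>2 / 2))) \<circ> (*) (inverse (- (x\<^sup>2 * exp (- x\<^sup>2 / 2)))) = id"
        using x(1) by (simp add: fun_eq_iff field_simps del: inverse_minus_eq inverse_mult_distrib)
    qed (use x(1) inv continuous_on_gauss_tail in auto)
    then have "(u0 has_real_derivative inverse (- (x\<^sup>2 * exp (- x\<^sup>2 / 2))) * (- K)) (at t)"
      unfolding u0_def[abs_def] x(2)
      by (rule DERIV_chain2) (auto intro!: derivative_eq_intros)
    moreover have "inverse (- (x\<^sup>2 * exp (- x\<^sup>2 / 2))) * (- K) = u1 t / (u0 t)\<^sup>2"
      using x(1) by (simp add: u1_def u0t exp_minus field_simps)
    ultimately have D0: "(u0 has_real_derivative u1 t / (u0 t)\<^sup>2) (at t)" by simp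
    have "(u1 has_real_derivative (u1 t)\<^sup>2 / u0 t) (at t)"
    proof -
      have "((\<lambda>t. K * exp ((u0 t)\<^sup>2 / 2)) has_real_derivative
          K * (exp ((u0 t)\<^sup>2 / 2) * (u0 t * (u1 t / (u0 t)\<^sup>2)))) (at t)"
        by (auto intro!: derivative_eq_intros D0)
      also have "K * (exp ((u0 t)\<^sup>2 / 2) * (u0 t * (u1 t / (u0 t)\<^sup>2))) = (u1 t)\<^sup>2 / u0 t"
        using x(1) by (simp add: u1_def u0t power2_eq_square field_simps)
      finally show ?thesis unfolding u1_def[abs_def] .
    qed
    with D0 x(1) u0t show ?thesis by (auto intro: has_field_derivative_at_within)
  qed
  ultimately have "solution_on a b (ereal (lifetime a b)) u0 u1"
    using u0_0 lifetime_pos[OF assms] by (simp add: solution_on_def)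
  then show ?thesis by blast
qed

text \<open>
  Uniqueness rests on the injectivity of the tail: the implicit equation determines \<open>u0 t\<close>, and the
  conserved quantity then determines \<open>u1 t\<close>.
\<close>

lemma solution_unique:
  assumes "solution_on a b T u0 u1" "solution_on a b T' v0 v1" "a > 0"
    and "0 \<le> t" "ereal t < T" "ereal t < T'"
  shows "v0 t = u0 t" "v1 t = u1 t"
proof -
  have "gauss_tail (v0 t) = gauss_tail (u0 t)" "v0 t > 0" "u0 t > 0"
    using solution_implicit(2)[OF assms(1)] solution_implicit(2)[OF assms(2)]
      solution_pos[OF assms(1)] solution_pos[OF assms(2)] assms by auto
  then show "v0 t = u0 t" using inj_on_gauss_tail by (auto dest: inj_onD)
  then show "v1 t = u1 t"
    using solution_implicit(1)[OF assms(1)] solution_implicit(1)[OF assms(2)] assms by simp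
qed

lemma maximal_solution_exists:
  assumes "a > 0" "b > 0"
  shows "\<exists>T u0 u1. maximal_solution a b T u0 u1"
proof -
  obtain u0 u1 where "solution_on a b (ereal (lifetime a b)) u0 u1"
    using explicit_solution[OF assms] by blast
  then have "maximal_solution a b (ereal (lifetime a b)) u0 u1"
    unfolding maximal_solution_def using lifetime_le[OF _ assms] leD by blast
  then show ?thesis by blast
qed

lemma maximal_solution_lifetime:
  assumes max: "maximal_solution a b T u0 u1" and "a > 0" "b > 0"
  shows "T = ereal (lifetime a b)"
proof (rule antisym)
  have sol: "solution_on a b T u0 u1" using max by (simp add: maximal_solution_def)
  then show "T \<le> ereal (lifetime a b)" by (rule lifetime_le) fact+
  obtain v0 v1 where v: "solution_on a b (ereal (lifetime a b)) v0 v1"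
    using explicit_solution[OF assms(2,3)] by blast
  show "ereal (lifetime a b) \<le> T"
  proof (rule ccontr)
    assume "\<not> ?thesis"
    then have less: "T < ereal (lifetime a b)" by simp
    then have "\<forall>t\<ge>0. ereal t < T \<longrightarrow> v0 t = u0 t \<and> v1 t = u1 t"
      using solution_unique[OF sol v \<open>a > 0\<close>] by (meson less_trans)
    with less v max show False unfolding maximal_solution_def by blast
  qed
qed

section \<open>Blow-up rates\<close>

lemma solution_tendsto_infinity:
  assumes sol: "solution_on a b (ereal (lifetime a b)) u0 u1" and "a > 0" "b > 0"
  shows "filterlim u0 at_top (at_left (lifetime a b))"
proof (rule filterlim_at_top_gt[where c = 0, THEN iffD2], intro allI impI)
  fix N :: real assume N: "N > 0"
  let ?s = "lifetime a b" and ?K = "b * exp (- a\<^sup>2 / 2)"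
  have "((\<lambda>t. ?K * (?s - t)) \<longlongrightarrow> ?K * (?s - ?s)) (at_left ?s)"
    by (intro tendsto_intros)
  then have "\<forall>\<^sub>F t in at_left ?s. ?K * (?s - t) < gauss_tail N"
    using gauss_tail_pos[OF N] by (intro order_tendstoD) auto
  moreover have "\<forall>\<^sub>F t in at_left ?s. t \<in> {0<..<?s}"
    using lifetime_pos assms by (intro eventually_at_left_real) auto
  ultimately show "\<forall>\<^sub>F t in at_left ?s. N \<le> u0 t"
  proof eventually_elim
    case (elim t)
    then have "gauss_tail (u0 t) < gauss_tail N" "u0 t > 0"
      using gauss_tail_solution[OF assms, of t] solution_pos[OF sol \<open>a > 0\<close>, of t] by auto
    with N show ?case by (simp add: gauss_tail_less_iff)
  qed
qed

text \<open>
  Near the blow-up time \<open>1 / (t\<^sub>* - t) = K / W (u0 t)\<close>, so both rates are limits in the single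
  variable \<open>x = u0 t\<close>.  The constant is \<open>sqrt 2\<close> in both of them.
\<close>

lemma solution_rates:
  assumes sol: "solution_on a b (ereal (lifetime a b)) u0 u1" and ab: "a > 0" "b > 0"
  defines "s \<equiv> lifetime a b"
  shows "asymp_as_left u0 (\<lambda>t. sqrt 2 * ln (inverse (s - t)) powr (1/2)) s"
    and "asymp_as_left u1 (\<lambda>t. sqrt 2 * inverse (s - t) * ln (inverse (s - t)) powr (1/2)) s"
    and "blows_up_at u1 s"
proof -
  define K where "K = b * exp (- a\<^sup>2 / 2)"
  have K: "K > 0" using ab by (simp add: K_def)
  let ?R = "\<lambda>x. x / (sqrt 2 * ln (K / gauss_tail x) powr (1 / 2))"
  have lim: "filterlim u0 at_top (at_left s)"
    unfolding s_def by (rule solution_tendsto_infinity) fact+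
  have ev: "\<forall>\<^sub>F t in at_left s. u0 t > 0 \<and> inverse (s - t) = K / gauss_tail (u0 t)
      \<and> u1 t = K * exp ((u0 t)\<^sup>2 / 2)"
  proof -
    have "\<forall>\<^sub>F t in at_left s. t \<in> {0<..<s}"
      using lifetime_pos ab by (intro eventually_at_left_real) (auto simp: s_def)
    then show ?thesis
    proof eventually_elim
      case (elim t)
      then have t: "0 \<le> t" "ereal t < ereal (lifetime a b)" by (auto simp: s_def)
      have "gauss_tail (u0 t) = K * (s - t)"
        using gauss_tail_solution[OF sol ab t] by (simp add: K_def s_def)
      then have "inverse (s - t) = K / gauss_tail (u0 t)"
        using K by (simp add: divide_inverse)
      with solution_implicit(1)[OF sol ab(1) t] solution_pos[OF sol ab(1) t]
      show ?case by (simp add: K_def)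
    qed
  qed
  have R: "((\<lambda>t. ?R (u0 t)) \<longlongrightarrow> 1) (at_left s)"
    by (rule filterlim_compose[OF sqrt_ln_gauss_tail_asymp[OF K] lim])
  have "((\<lambda>t. u0 t / (sqrt 2 * ln (inverse (s - t)) powr (1/2))) \<longlongrightarrow> 1) (at_left s)"
    by (rule Lim_transform_eventually[OF R]) (use ev in eventually_elim, simp)
  from tendsto_rabs[OF this]
  show "asymp_as_left u0 (\<lambda>t. sqrt 2 * ln (inverse (s - t)) powr (1/2)) s"
    by (simp add: asymp_as_left_def)
  have "((\<lambda>t. gauss_tail (u0 t) * exp ((u0 t)\<^sup>2 / 2) / u0 t * ?R (u0 t)) \<longlongrightarrow> 1 * 1) (at_left s)"
    by (intro tendsto_mult R filterlim_compose[OF gauss_tail_asymp lim])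
  then have "((\<lambda>t. u1 t / (sqrt 2 * inverse (s - t) * ln (inverse (s - t)) powr (1/2)))
      \<longlongrightarrow> 1 * 1) (at_left s)"
  proof (rule Lim_transform_eventually)
    show "\<forall>\<^sub>F t in at_left s. gauss_tail (u0 t) * exp ((u0 t)\<^sup>2 / 2) / u0 t * ?R (u0 t) =
        u1 t / (sqrt 2 * inverse (s - t) * ln (inverse (s - t)) powr (1/2))"
      using ev
    proof eventually_elim
      case (elim t)
      then show ?case using K gauss_tail_pos[of "u0 t"] by simp
    qed
  qed
  from tendsto_rabs[OF this]
  show "asymp_as_left u1 (\<lambda>t. sqrt 2 * inverse (s - t) * ln (inverse (s - t)) powr (1/2)) s"
    by (simp add: asymp_as_left_def)
  have "filterlim (\<lambda>x. \<bar>K * exp (x\<^sup>2 / 2)\<bar>) at_top at_top"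
    using K by real_asymp
  from filterlim_compose[OF this lim] have "filterlim (\<lambda>t. \<bar>K * exp ((u0 t)\<^sup>2 / 2)\<bar>) at_top (at_left s)" .
  moreover have "\<forall>\<^sub>F t in at_left s. \<bar>K * exp ((u0 t)\<^sup>2 / 2)\<bar> = \<bar>u1 t\<bar>"
    using ev by eventually_elim simp
  ultimately show "blows_up_at u1 s"
    by (simp add: blows_up_at_def filterlim_cong)
qed

theorem theorem4p3:
  fixes a :: real
  assumes "a > 0"
  shows "\<exists>M>0. \<forall>b\<ge>M.
    (\<exists>T u0 u1. maximal_solution a b T u0 u1) \<and>
    (\<forall>T u0 u1. maximal_solution a b T u0 u1 \<longrightarrow>
      (\<exists>tmax. T = ereal tmax \<and>
        blows_up_at u1 tmax \<and>
        (\<exists>C>0. asymp_as_left u1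
           (\<lambda>t. C * inverse (tmax - t) * ln (inverse (tmax - t)) powr (1/2)) tmax) \<and>
        blows_up_at u0 tmax \<and>
        (\<exists>C>0. asymp_as_left u0
           (\<lambda>t. C * ln (inverse (tmax - t)) powr (1/2)) tmax)))"
proof (rule exI[of _ 1], intro conjI allI impI)
  fix b :: real assume "1 \<le> b"
  then have b: "b > 0" by simp
  show "\<exists>T u0 u1. maximal_solution a b T u0 u1"
    using assms b by (rule maximal_solution_exists)
  fix T u0 u1 assume max: "maximal_solution a b T u0 u1"
  have T: "T = ereal (lifetime a b)"
    using max assms b by (rule maximal_solution_lifetime)
  with max have sol: "solution_on a b (ereal (lifetime a b)) u0 u1"
    by (simp add: maximal_solution_def)
  have "blows_up_at u0 (lifetime a b)"
    unfolding blows_up_at_def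
    by (rule filterlim_compose[OF filterlim_abs_real solution_tendsto_infinity[OF sol assms b]])
  moreover have "sqrt 2 > 0" by simp
  ultimately show "\<exists>tmax. T = ereal tmax \<and>
        blows_up_at u1 tmax \<and>
        (\<exists>C>0. asymp_as_left u1
           (\<lambda>t. C * inverse (tmax - t) * ln (inverse (tmax - t)) powr (1/2)) tmax) \<and>
        blows_up_at u0 tmax \<and>
        (\<exists>C>0. asymp_as_left u0
           (\<lambda>t. C * ln (inverse (tmax - t)) powr (1/2)) tmax)"
    using T solution_rates[OF sol assms b] by blast
qed simp

end
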